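(* Let $J$ be a bounded interval, let $1\le p\le\infty$, and let $\omega$ be a weight on $J$ with mean value one on $J$ such that $\omega\in\mathbf{A}_p^d$. Then $\omega_\lambda\in\mathbf{A}_p^d$ for all $0\le\lambda\le1$, where $\omega_\lambda$ is the weight obtained from $\omega$ by the $\lambda$-operation.
   Context: Let $J$ be a bounded interval (e.g. $J=[0,1]$). $\mathcal{D}(J)$ denotes the family of dyadic subintervals of $J$, i.e. the intervals obtained from $J$ (including $J$ itself) by repeated bisection. For $I\in\mathcal{D}(J)$, $I_l$ and $I_r$ are its left and right halves, and $\widetilde I$ is the parent of $I$ (for $I\neq J$) if $I=\widetilde I_l$ or $I=\widetilde I_r$. $|I|$ is the length of $I$, and $m_I f=\frac1{|I|}\int_I f$. The Haar function of $I$ is $h_I=|I|^{-1/2}(\chi_{I_r}-\chi_{I_l})$, and $\langle\cdot,\cdot\rangle$ is the $L^2$ pairing $\langle f,g\rangle=\int fg$. A weight on $J$ is a positive (a.e.) locally integrable function on $J$ (integrable on $J$). It is dyadic doubling if there is a constant $C$ with $\int_{\widetilde I}\omega\le C\int_I\omega$ for all $I\in\mathcal{D}(J)$, $I\ne J$. The dyadic doubling classes $\mathbf{A}_p^d$: a dyadic doubling weight $\omega$ is in - $\mathbf{A}_\infty^d$ if there is a constant $C$ with $\frac1{|I|}\int_I\omega\le C\exp\left(\frac1{|I|}\int_I\log\omega\right)$ for all $I\in\mathcal{D}(J)$; - $\mathbf{A}_p^d$, $1<p<\infty$, if there is a constant $C$ with $\left(\frac1{|I|}\int_I\omega\right)\left(\frac1{|I|}\int_I\omega^{-1/(p-1)}\right)^{p-1}\le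 C$ for all $I\in\mathcal{D}(J)$; - $\mathbf{A}_1^d$ if there is a constant $C$ with $\frac1{|I|}\int_I\omega\le C\,\omega(x)$ for a.e. $x\in I$, for all $I\in\mathcal{D}(J)$. The $\lambda$-operation: for a weight $\omega$ with mean value one on $J$ put $b_I=\langle\omega,h_I\rangle/m_I\omega$ for $I\in\mathcal{D}(J)$, so that $\omega(x)=\prod_{I\in\mathcal{D}(J)}(1+b_Ih_I(x))$; for $-1\le\lambda\le1$ define $$\omega_\lambda(x)=\prod_{I\in\mathcal{D}(J)}\bigl(1+\lambda b_Ih_I(x)\bigr),$$ the infinite product being the almost everywhere limit as $n\to\infty$ of the partial products over those $I\in\mathcal{D}(J)$ with $|I|>2^{-n}|J|$. *)

theory Defs
  imports "HOL-Analysis.Analysis"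
begin

text \<open>An interval is represented by its pair of endpoints \<open>(c, d)\<close> and stands for the half-open
  interval \<open>[c, d)\<close>, so that bisection gives an exact partition. All notions below are insensitive
  to null sets, hence to which endpoints belong to \<open>J\<close>. A function on \<open>J\<close> is a
  function on the reals whose values outside \<open>J\<close> play no role.\<close>

type_synonym ivl = "real \<times> real"

definition pts :: "ivl \<Rightarrow> real set" where
  "pts I = {fst I..<snd I}"

definition len :: "ivl \<Rightarrow> real" where
  "len I = snd I - fst I"

definition left_half :: "ivl \<Rightarrow> ivl" where
  "left_half I = (fst I, (fst I + snd I) / 2)"

definition right_half :: "ivl \<Rightarrow> ivl" where
  "right_half I = ((fst I + snd I) / 2, snd I)"

inductive_set dyadic :: "ivl \<Rightarrow> ivl set" for J :: ivl where
  root: "J \<in> dyadic J"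
| left: "I \<in> dyadic J \<Longrightarrow> left_half I \<in> dyadic J"
| right: "I \<in> dyadic J \<Longrightarrow> right_half I \<in> dyadic J"

definition is_parent :: "ivl \<Rightarrow> ivl \<Rightarrow> bool" where
  "is_parent I' I \<longleftrightarrow> I = left_half I' \<or> I = right_half I'"

definition integral_on :: "ivl \<Rightarrow> (real \<Rightarrow> real) \<Rightarrow> real" where
  "integral_on I f = (LINT x:pts I|lebesgue. f x)"

definition integrable_on_ivl :: "(real \<Rightarrow> real) \<Rightarrow> ivl \<Rightarrow> bool" where
  "integrable_on_ivl f I \<longleftrightarrow> set_integrable lebesgue (pts I) f"

definition mean_on :: "ivl \<Rightarrow> (real \<Rightarrow> real) \<Rightarrow> real" where
  "mean_on I f = 1 / len I * integral_on I f"

definition haar :: "ivl \<Rightarrow> real \<Rightarrow> real" where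
  "haar I x = len I powr (- 1 / 2) *
     (indicat_real (pts (right_half I)) x - indicat_real (pts (left_half I)) x)"

definition pairing :: "ivl \<Rightarrow> (real \<Rightarrow> real) \<Rightarrow> (real \<Rightarrow> real) \<Rightarrow> real" where
  "pairing J f g = integral_on J (\<lambda>x. f x * g x)"

definition is_weight :: "ivl \<Rightarrow> (real \<Rightarrow> real) \<Rightarrow> bool" where
  "is_weight J w \<longleftrightarrow> integrable_on_ivl w J \<and> (AE x in lebesgue. x \<in> pts J \<longrightarrow> 0 < w x)"

definition dyadic_doubling :: "ivl \<Rightarrow> (real \<Rightarrow> real) \<Rightarrow> bool" where
  "dyadic_doubling J w \<longleftrightarrow>
     (\<exists>C. \<forall>I\<in>dyadic J. \<forall>I'\<in>dyadic J. is_parent I' I \<longrightarrow> integral_on I' w \<le> C * integral_on I w)"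

text \<open>The Bochner integral of a non-integrable function is \<open>0\<close>, whereas in the conditions below
  a divergent integral has to be read as \<open>-\<infinity>\<close> (for \<open>log \<omega>\<close>, whose positive part is always
  integrable) or as \<open>\<infinity>\<close> (for the negative power); in both cases the condition fails.
  Integrability is therefore required explicitly.\<close>

definition A_infty_cond :: "ivl \<Rightarrow> (real \<Rightarrow> real) \<Rightarrow> bool" where
  "A_infty_cond J w \<longleftrightarrow>
     (\<exists>C. \<forall>I\<in>dyadic J. integrable_on_ivl (\<lambda>x. ln (w x)) I \<and>
        mean_on I w \<le> C * exp (mean_on I (\<lambda>x. ln (w x))))"

definition A_p_cond :: "real \<Rightarrow> ivl \<Rightarrow> (real \<Rightarrow> real) \<Rightarrow> bool" where
  "A_p_cond p J w \<longleftrightarrow>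
     (\<exists>C. \<forall>I\<in>dyadic J. integrable_on_ivl (\<lambda>x. w x powr (- 1 / (p - 1))) I \<and>
        mean_on I w * mean_on I (\<lambda>x. w x powr (- 1 / (p - 1))) powr (p - 1) \<le> C)"

definition A_1_cond :: "ivl \<Rightarrow> (real \<Rightarrow> real) \<Rightarrow> bool" where
  "A_1_cond J w \<longleftrightarrow>
     (\<exists>C. \<forall>I\<in>dyadic J. AE x in lebesgue. x \<in> pts I \<longrightarrow> mean_on I w \<le> C * w x)"

definition A_dyadic :: "ereal \<Rightarrow> ivl \<Rightarrow> (real \<Rightarrow> real) set" where
  "A_dyadic p J = {w. is_weight J w \<and> dyadic_doubling J w \<and>
     (if p = \<infinity> then A_infty_cond J w
      else if p = 1 then A_1_cond J w
      else A_p_cond (real_of_ereal p) J w)}"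

definition b_coeff :: "ivl \<Rightarrow> (real \<Rightarrow> real) \<Rightarrow> ivl \<Rightarrow> real" where
  "b_coeff J w I = pairing J w (haar I) / mean_on I w"

definition lambda_partial :: "ivl \<Rightarrow> (real \<Rightarrow> real) \<Rightarrow> real \<Rightarrow> nat \<Rightarrow> real \<Rightarrow> real" where
  "lambda_partial J w l n x =
     (\<Prod>I | I \<in> dyadic J \<and> len I > len J / 2 ^ n. 1 + l * b_coeff J w I * haar I x)"

text \<open>The value is meaningful only at points where the partial products converge.\<close>

definition lambda_op :: "ivl \<Rightarrow> (real \<Rightarrow> real) \<Rightarrow> real \<Rightarrow> real \<Rightarrow> real" where
  "lambda_op J w l x = lim (\<lambda>n. lambda_partial J w l n x)"

text \<open>The products in \<open>lambda_partial\<close> are genuine finite products (a product over an infinite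
  set would be \<open>1\<close> by convention).\<close>

lemma finite_dyadic_len_gt:
  assumes "0 < len J"
  shows "finite {I \<in> dyadic J. len I > len J / 2 ^ n}"
proof -
  define G where "G = rec_nat {J} (\<lambda>_ S. left_half ` S \<union> right_half ` S)"
  have G0: "G 0 = {J}" and GS: "G (Suc m) = left_half ` G m \<union> right_half ` G m" for m
    by (simp_all add: G_def)
  have fin: "finite (G m)" for m
    by (induction m) (simp_all add: G0 GS)
  have half: "len (left_half I) = len I / 2" "len (right_half I) = len I / 2" for I
    by (simp_all add: len_def left_half_def right_half_def field_simps)
  have "\<exists>m. I \<in> G m \<and> len I = len J / 2 ^ m" if "I \<in> dyadic J" for I
    using that
  proof induction
    case root
    show ?case by (rule exI[of _ 0]) (simp add: G0)
  next
    case (left I)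
    then obtain m where "I \<in> G m" "len I = len J / 2 ^ m" by blast
    then show ?case by (intro exI[of _ "Suc m"]) (simp add: GS half)
  next
    case (right I)
    then obtain m where "I \<in> G m" "len I = len J / 2 ^ m" by blast
    then show ?case by (intro exI[of _ "Suc m"]) (simp add: GS half)
  qed
  moreover have "m < n" if "len J / 2 ^ m > len J / 2 ^ n" for m
  proof (rule ccontr)
    assume "\<not> m < n"
    then have "(2::real) ^ n \<le> 2 ^ m" by (simp add: power_increasing)
    then have "len J / 2 ^ m \<le> len J / 2 ^ n"
      using assms by (intro divide_left_mono) auto
    with that show False by simp
  qed
  ultimately have "{I \<in> dyadic J. len I > len J / 2 ^ n} \<subseteq> (\<Union>m<n. G m)"
    by fastforce
  then show ?thesis
    using fin by (meson finite_UN finite_lessThan finite_subset)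
qed

end

theory Submission imports Defs begin

text \<open>
  Let \<open>u\<close> run through the ratios of the mean of \<open>\<omega>\<close> over a half of a dyadic interval to its mean over
  the interval. Along the branch of a point \<open>x\<close> the product of these ratios telescopes to the means
  of \<open>\<omega>\<close> over the dyadic intervals shrinking to \<open>x\<close>, which tend to \<open>\<omega>(x)\<close> for almost every \<open>x\<close>
  (\<open>mean_on_cell_tendsto\<close>). The \<open>\<lambda>\<close>-operation replaces \<open>u\<close> by \<open>1 - \<lambda> + \<lambda> u\<close>, and the whole proof
  rests on the inequality \<open>u\<^sup>\<lambda> \<le> 1 - \<lambda> + \<lambda> u\<close> (\<open>powr_le_affine\<close>).

  Convergence: the inequality makes the quotient of the partial product by the \<open>\<lambda>\<close>-th power of the
  mean of \<open>\<omega>\<close> increase along the branch, so the partial products converge unless they tend to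
  infinity. They form a martingale (\<open>lambda_partial_martingale\<close>), and by Fatou's lemma they tend to
  infinity only on a null set (\<open>lambda_partial_tendsto\<close>).

  Bounds: let \<open>I\<close> be a dyadic interval, \<open>m\<close> the mean of \<open>\<omega>\<close> over \<open>I\<close> and \<open>c\<close> the value on \<open>I\<close> of the
  partial product over the proper ancestors of \<open>I\<close>. Then \<open>\<omega>\<^sub>\<lambda>\<close> has mean at most \<open>c\<close> over \<open>I\<close>, by Fatou's
  lemma again (\<open>lambda_op_mean_le_on_node\<close>), and \<open>\<omega>\<^sub>\<lambda> \<ge> c (\<omega> / m)\<^sup>\<lambda>\<close> almost everywhere on \<open>I\<close>
  (\<open>lambda_op_ge_on_node\<close>). Inserting these two facts into each of the three conditions yields the
  condition for \<open>\<omega>\<^sub>\<lambda>\<close>.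

  Doubling also needs a lower bound for the mean of \<open>\<omega>\<^sub>\<lambda>\<close> by a multiple of \<open>c\<close>. For a weight in the
  limiting class \<open>p = \<infinity>\<close>, averaging the logarithm of the pointwise bound and Jensen's inequality give it
  (\<open>lambda_op_exp_mean_ln\<close>, \<open>lambda_op_doubling\<close>), and the classes for finite \<open>p\<close> are contained in that
  class (\<open>A_1_imp_A_infty\<close>, \<open>A_p_imp_A_infty\<close>).
\<close>

section \<open>Elementary inequalities\<close>

text \<open>Bernoulli's inequality for an exponent between \<open>0\<close> and \<open>1\<close>, here as a case of the weighted
  inequality between geometric and arithmetic means. With \<open>u = 1 + t\<close> it reads
  \<open>(1 + t)\<^sup>l \<le> 1 + l t\<close>, which compares each factor of the modified product with the \<open>l\<close>-th power
  of the original factor.\<close>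

lemma powr_le_affine:
  fixes u l :: real
  assumes "0 < u" "0 \<le> l" "l \<le> 1"
  shows "u powr l \<le> 1 - l + l * u"
  using Youngs_inequality_0[of l "1 - l" u 1] assms by simp

lemma affine_ratio_pos:
  fixes u l :: real
  assumes "0 < u" "0 \<le> l" "l \<le> 1"
  shows "0 < 1 - l + l * u"
  using powr_le_affine[OF assms] assms(1) powr_gt_zero[of u l] by linarith

section \<open>Means over intervals\<close>

lemma pts_measurable [measurable]: "pts I \<in> sets lebesgue"
  by (simp add: pts_def)

lemma emeasure_pts: "0 \<le> len I \<Longrightarrow> emeasure lebesgue (pts I) = ennreal (len I)"
  by (simp add: pts_def len_def)

lemma integrable_on_ivl_const: "integrable_on_ivl (\<lambda>_. c) I"
proof -
  have "emeasure lebesgue (pts I) < \<infinity>"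
    by (cases "fst I \<le> snd I") (simp_all add: pts_def)
  then have "integrable lebesgue (indicat_real (pts I))"
    by (simp add: integrable_indicator_iff)
  then show ?thesis
    by (simp add: integrable_on_ivl_def set_integrable_def)
qed

lemma integral_on_const: "0 \<le> len I \<Longrightarrow> integral_on I (\<lambda>_. c) = c * len I"
  using emeasure_pts[of I]
  by (simp add: integral_on_def set_integral_const measure_def del: emeasure_completion)

lemma mean_on_affine:
  assumes "0 < len I" "integrable_on_ivl f I"
  shows "mean_on I (\<lambda>x. \<alpha> + \<beta> * f x) = \<alpha> + \<beta> * mean_on I f"
proof -
  have "integral_on I (\<lambda>x. \<alpha> + \<beta> * f x) = integral_on I (\<lambda>_. \<alpha>) + integral_on I (\<lambda>x. \<beta> * f x)"
    unfolding integral_on_def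
    using assms(2) integrable_on_ivl_const[of \<alpha> I]
    by (intro set_integral_add) (simp_all add: integrable_on_ivl_def)
  also have "\<dots> = \<alpha> * len I + \<beta> * integral_on I f"
    using integral_on_const[of I \<alpha>] assms(1) by (simp add: integral_on_def)
  finally show ?thesis
    using assms(1) by (simp add: mean_on_def field_simps)
qed

lemma mean_on_mono_AE:
  assumes "0 < len I" "integrable_on_ivl f I" "integrable_on_ivl g I"
    and "AE x in lebesgue. x \<in> pts I \<longrightarrow> f x \<le> g x"
  shows "mean_on I f \<le> mean_on I g"
  unfolding mean_on_def integral_on_def
  using assms by (intro mult_left_mono set_integral_mono_AE) (auto simp: integrable_on_ivl_def)

lemma integrable_on_ivl_affine:
  assumes "integrable_on_ivl f I"
  shows "integrable_on_ivl (\<lambda>x. \<alpha> + \<beta> * f x) I"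
  using assms integrable_on_ivl_const[of \<alpha> I]
  unfolding integrable_on_ivl_def by (intro set_integral_add) simp_all

lemma mean_on_le_affine:
  assumes "0 < len I" "integrable_on_ivl f I" "integrable_on_ivl g I"
    and "AE x in lebesgue. x \<in> pts I \<longrightarrow> f x \<le> \<alpha> + \<beta> * g x"
  shows "mean_on I f \<le> \<alpha> + \<beta> * mean_on I g"
  using mean_on_mono_AE[OF assms(1,2) integrable_on_ivl_affine[OF assms(3), of \<alpha> \<beta>]] assms
  by (simp add: mean_on_affine)

lemma mean_on_ge_affine:
  assumes "0 < len I" "integrable_on_ivl f I" "integrable_on_ivl g I"
    and "AE x in lebesgue. x \<in> pts I \<longrightarrow> \<alpha> + \<beta> * g x \<le> f x"
  shows "\<alpha> + \<beta> * mean_on I g \<le> mean_on I f"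
  using mean_on_mono_AE[OF assms(1) integrable_on_ivl_affine[OF assms(3), of \<alpha> \<beta>] assms(2)] assms
  by (simp add: mean_on_affine)

lemma integrable_on_ivl_subset:
  "integrable_on_ivl f J \<Longrightarrow> pts I \<subseteq> pts J \<Longrightarrow> integrable_on_ivl f I"
  unfolding integrable_on_ivl_def by (rule set_integrable_subset) auto

lemma is_weight_subset: "is_weight J w \<Longrightarrow> pts I \<subseteq> pts J \<Longrightarrow> is_weight I w"
  unfolding is_weight_def by (auto intro: integrable_on_ivl_subset)

lemma mean_on_pos:
  assumes "0 < len I" "is_weight I f"
  shows "0 < mean_on I f"
proof -
  let ?g = "\<lambda>x. indicator (pts I) x *\<^sub>R f x"
  have int: "integrable lebesgue ?g" and pos: "AE x in lebesgue. x \<in> pts I \<longrightarrow> 0 < f x"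
    using assms(2) by (auto simp: is_weight_def integrable_on_ivl_def set_integrable_def)
  have nonneg: "AE x in lebesgue. 0 \<le> ?g x"
    using pos by eventually_elim (auto simp: indicator_def)
  have "integral\<^sup>L lebesgue ?g \<noteq> 0"
  proof
    assume "integral\<^sup>L lebesgue ?g = 0"
    then have "AE x in lebesgue. ?g x = 0"
      using integral_nonneg_eq_0_iff_AE[OF int nonneg] by simp
    with pos have "AE x in lebesgue. x \<notin> pts I"
      by eventually_elim (auto simp: indicator_def)
    then have "emeasure lebesgue (pts I) = 0"
      by (subst (asm) AE_iff_measurable[OF pts_measurable]) auto
    with assms(1) emeasure_pts[of I] show False by (simp del: emeasure_completion)
  qed
  moreover have "0 \<le> integral\<^sup>L lebesgue ?g"
    using nonneg by (rule integral_nonneg_AE)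
  ultimately show ?thesis
    using assms(1) by (simp add: mean_on_def integral_on_def set_lebesgue_integral_def)
qed

text \<open>Jensen's inequality for the logarithm. The tangent line to \<open>ln\<close> at the mean lies above \<open>ln\<close>;
  averaging it gives the claim.\<close>

lemma mean_on_ln_le:
  assumes "0 < len I" "is_weight I f" "integrable_on_ivl (\<lambda>x. ln (f x)) I"
  shows "mean_on I (\<lambda>x. ln (f x)) \<le> ln (mean_on I f)"
proof -
  let ?m = "mean_on I f"
  have m: "0 < ?m" by (rule mean_on_pos[OF assms(1,2)])
  have "AE x in lebesgue. x \<in> pts I \<longrightarrow> 0 < f x" "integrable_on_ivl f I"
    using assms(2) by (auto simp: is_weight_def)
  moreover from this(1)
  have "AE x in lebesgue. x \<in> pts I \<longrightarrow> ln (f x) \<le> (ln ?m - 1) + (1 / ?m) * f x"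
  proof eventually_elim
    case (elim x)
    show ?case
      using elim m ln_diff_le[of "f x" ?m] by (auto simp: field_simps)
  qed
  ultimately have "mean_on I (\<lambda>x. ln (f x)) \<le> (ln ?m - 1) + (1 / ?m) * ?m"
    using mean_on_le_affine assms by blast
  with m show ?thesis by simp
qed

lemma integrable_on_ivl_bound:
  assumes "integrable_on_ivl g I"
    and "(\<lambda>x. indicator (pts I) x *\<^sub>R f x) \<in> borel_measurable lebesgue"
    and "AE x in lebesgue. x \<in> pts I \<longrightarrow> \<bar>f x\<bar> \<le> g x"
  shows "integrable_on_ivl f I"
  unfolding integrable_on_ivl_def
proof (rule set_integrable_bound[OF assms(1)[unfolded integrable_on_ivl_def]])
  show "set_borel_measurable lebesgue (pts I) f"
    using assms(2) by (simp add: set_borel_measurable_def)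
  show "AE x in lebesgue. x \<in> pts I \<longrightarrow> norm (f x) \<le> norm (g x)"
    using assms(3) by eventually_elim auto
qed

text \<open>An integrable function is only known to be measurable after multiplication by the indicator of
  the interval, so the indicator has to be moved inside the logarithm.\<close>

lemma integrable_on_ivl_measurable_ln:
  assumes "integrable_on_ivl f I"
  shows "(\<lambda>x. indicator (pts I) x *\<^sub>R ln (f x)) \<in> borel_measurable lebesgue"
proof -
  have [measurable]: "(\<lambda>x. indicator (pts I) x *\<^sub>R f x) \<in> borel_measurable lebesgue"
    using assms by (auto simp: integrable_on_ivl_def set_integrable_def)
  have "(\<lambda>x. indicator (pts I) x *\<^sub>R ln (f x)) =
      (\<lambda>x. indicator (pts I) x *\<^sub>R ln (indicator (pts I) x *\<^sub>R f x))"
    by (auto simp: indicator_def)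
  also have "\<dots> \<in> borel_measurable lebesgue" by measurable
  finally show ?thesis .
qed

section \<open>Consequences of Fatou's lemma\<close>

text \<open>By Fatou's lemma the lower limit of the sequence has an integral of at most \<open>c\<close>, so it is finite
  almost everywhere, which excludes divergence to infinity before any limit is known to exist. Where
  there is a limit, it agrees with the lower limit.\<close>

lemma Fatou_set_integral:
  fixes f :: "nat \<Rightarrow> 'a \<Rightarrow> real"
  assumes int: "\<And>n. set_integrable M A (f n)"
    and nonneg: "\<And>n x. x \<in> A \<Longrightarrow> 0 \<le> f n x"
    and val: "\<And>n. (LINT x:A|M. f n x) \<le> c"
  shows "AE x in M. x \<in> A \<longrightarrow> \<not> filterlim (\<lambda>n. f n x) at_top sequentially"
    and "(\<lambda>x. indicator A x *\<^sub>R g x) \<in> borel_measurable M \<Longrightarrow>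
      AE x in M. x \<in> A \<longrightarrow> (\<lambda>n. f n x) \<longlonglongrightarrow> g x \<Longrightarrow>
      set_integrable M A g \<and> (LINT x:A|M. g x) \<le> c"
proof -
  define F where "F n x = ennreal (indicator A x *\<^sub>R f n x)" for n x
  have int': "integrable M (\<lambda>x. indicator A x *\<^sub>R f n x)" for n
    using int by (simp add: set_integrable_def)
  then have [measurable]: "F n \<in> borel_measurable M" for n
    unfolding F_def by measurable
  have "integral\<^sup>N M (F n) = ennreal (LINT x:A|M. f n x)" for n
    unfolding F_def set_lebesgue_integral_def
    by (rule nn_integral_eq_integral[OF int']) (auto simp: indicator_def nonneg)
  then have "integral\<^sup>N M (F n) \<le> ennreal c" for n
    using val by (simp add: ennreal_leI)
  then have "liminf (\<lambda>n. integral\<^sup>N M (F n)) \<le> ennreal c"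
    by (intro order_trans[OF Liminf_le_Limsup Limsup_bounded]) simp_all
  then have Fatou: "(\<integral>\<^sup>+ x. liminf (\<lambda>n. F n x) \<partial>M) \<le> ennreal c"
    using nn_integral_liminf[of F M] by (simp add: order_trans)
  then have "(\<integral>\<^sup>+ x. liminf (\<lambda>n. F n x) \<partial>M) \<noteq> \<infinity>"
    by (metis ennreal_neq_top infinity_ennreal_def top.extremum_unique)
  then have "AE x in M. liminf (\<lambda>n. F n x) \<noteq> \<infinity>"
    by (intro nn_integral_PInf_AE) auto
  then show "AE x in M. x \<in> A \<longrightarrow> \<not> filterlim (\<lambda>n. f n x) at_top sequentially"
  proof eventually_elim
    case (elim x)
    show ?case
    proof (intro impI notI)
      assume "x \<in> A" "filterlim (\<lambda>n. f n x) at_top sequentially"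
      then have "(\<lambda>n. F n x) \<longlonglongrightarrow> top"
        by (simp add: F_def ennreal_tendsto_top_eq_at_top)
      then have "liminf (\<lambda>n. F n x) = top"
        by (rule lim_imp_Liminf[OF trivial_limit_sequentially])
      with elim show False by simp
    qed
  qed
  assume meas: "(\<lambda>x. indicator A x *\<^sub>R g x) \<in> borel_measurable M"
    and lim: "AE x in M. x \<in> A \<longrightarrow> (\<lambda>n. f n x) \<longlonglongrightarrow> g x"
  have g_nonneg: "AE x in M. 0 \<le> indicator A x *\<^sub>R g x"
    using lim
  proof eventually_elim
    case (elim x)
    then show ?case
      using nonneg LIMSEQ_le_const[of "\<lambda>n. f n x" "g x" 0] by (auto simp: indicator_def)
  qed
  have "AE x in M. liminf (\<lambda>n. F n x) = ennreal (indicator A x *\<^sub>R g x)"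
    using lim
  proof eventually_elim
    case (elim x)
    then have "(\<lambda>n. F n x) \<longlonglongrightarrow> ennreal (indicator A x *\<^sub>R g x)"
      unfolding F_def by (intro tendsto_ennrealI) (auto simp: indicator_def)
    then show ?case by (rule lim_imp_Liminf[OF trivial_limit_sequentially])
  qed
  then have "(\<integral>\<^sup>+ x. ennreal (indicator A x *\<^sub>R g x) \<partial>M) = (\<integral>\<^sup>+ x. liminf (\<lambda>n. F n x) \<partial>M)"
    by (intro nn_integral_cong_AE) (auto elim: eventually_mono)
  with Fatou have le: "(\<integral>\<^sup>+ x. ennreal (indicator A x *\<^sub>R g x) \<partial>M) \<le> ennreal c" by simp
  have "0 \<le> (LINT x:A|M. f 0 x)"
    unfolding set_lebesgue_integral_def by (rule integral_nonneg_AE) (auto simp: indicator_def nonneg)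
  then have "0 \<le> c" using val[of 0] by linarith
  then show "set_integrable M A g \<and> (LINT x:A|M. g x) \<le> c"
    using integrableI_nonneg[OF meas g_nonneg] le integral_real_bounded[OF \<open>0 \<le> c\<close> le]
    by (auto simp: set_integrable_def set_lebesgue_integral_def le_less_trans)
qed

section \<open>Dyadic intervals\<close>

lemma len_halves: "len (left_half I) = len I / 2" "len (right_half I) = len I / 2"
  by (simp_all add: len_def left_half_def right_half_def field_simps)

lemma pts_halves:
  assumes "0 < len I"
  shows "pts I = pts (left_half I) \<union> pts (right_half I)"
    and "pts (left_half I) \<inter> pts (right_half I) = {}"
  using assms by (auto simp: pts_def left_half_def right_half_def len_def field_simps)

lemma integral_on_halves:
  assumes "0 < len I" "integrable_on_ivl f I"
  shows "integral_on I f = integral_on (left_half I) f + integral_on (right_half I) f"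
  using assms pts_halves[OF assms(1)] set_integral_Un[of "pts (left_half I)" "pts (right_half I)" lebesgue f]
    integrable_on_ivl_subset[of f I "left_half I"] integrable_on_ivl_subset[of f I "right_half I"]
  by (simp add: integral_on_def integrable_on_ivl_def)

lemma integral_on_eq_mean_on: "0 < len I \<Longrightarrow> integral_on I f = mean_on I f * len I"
  by (simp add: mean_on_def)

lemma mean_on_halves:
  assumes "0 < len I" "integrable_on_ivl f I"
  shows "2 * mean_on I f = mean_on (left_half I) f + mean_on (right_half I) f"
  using assms integral_on_halves[OF assms] by (simp add: mean_on_def len_halves field_simps)

definition child :: "ivl \<Rightarrow> real \<Rightarrow> ivl" where
  "child I x = (if x < (fst I + snd I) / 2 then left_half I else right_half I)"

text \<open>The interval of generation \<open>n\<close> that contains \<open>x\<close>, found by walking down the binary tree. Following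
  a point makes the product over all dyadic intervals a product along one branch.\<close>

primrec cell :: "ivl \<Rightarrow> nat \<Rightarrow> real \<Rightarrow> ivl" where
  "cell J 0 x = J"
| "cell J (Suc n) x = child (cell J n x) x"

lemma child_eq:
  "x \<in> pts (left_half I) \<Longrightarrow> child I x = left_half I"
  "x \<in> pts (right_half I) \<Longrightarrow> child I x = right_half I"
  by (auto simp: child_def pts_def left_half_def right_half_def)

lemma mem_child: "x \<in> pts I \<Longrightarrow> x \<in> pts (child I x)"
  by (auto simp: child_def pts_def left_half_def right_half_def)

lemma len_child: "len (child I x) = len I / 2"
  by (simp add: child_def len_halves)

lemma len_cell: "len (cell J n x) = len J / 2 ^ n"
  by (induction n) (simp_all add: len_child)

lemma mem_cell: "x \<in> pts J \<Longrightarrow> x \<in> pts (cell J n x)"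
  by (induction n) (simp_all add: mem_child)

lemma cell_dyadic: "cell J n x \<in> dyadic J"
  by (induction n) (auto simp: child_def intro: dyadic.intros)

text \<open>Every dyadic interval is the cell of each of its points at one and the same generation, so the
  inductive definition of \<open>dyadic\<close> and the branches \<open>cell J n x\<close> describe the same tree.\<close>

lemma dyadic_is_cell:
  assumes "0 < len J" "I \<in> dyadic J"
  shows "pts I \<subseteq> pts J \<and> (\<exists>m. len I = len J / 2 ^ m \<and> (\<forall>x\<in>pts I. cell J m x = I))"
  using assms(2)
proof induction
  case root
  show ?case by (auto intro!: exI[of _ 0])
next
  case (left I)
  then obtain m where m: "len I = len J / 2 ^ m" "\<forall>x\<in>pts I. cell J m x = I" by blast
  with assms(1) have "0 < len I" by simp
  with left m show ?case
    using pts_halves[of I] by (auto simp: len_halves child_eq intro!: exI[of _ "Suc m"])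
next
  case (right I)
  then obtain m where m: "len I = len J / 2 ^ m" "\<forall>x\<in>pts I. cell J m x = I" by blast
  with assms(1) have "0 < len I" by simp
  with right m show ?case
    using pts_halves[of I] by (auto simp: len_halves child_eq intro!: exI[of _ "Suc m"])
qed

lemma dyadic_len_pos: "0 < len J \<Longrightarrow> I \<in> dyadic J \<Longrightarrow> 0 < len I"
  using dyadic_is_cell[of J I] by auto

lemma dyadic_subset: "0 < len J \<Longrightarrow> I \<in> dyadic J \<Longrightarrow> pts I \<subseteq> pts J"
  using dyadic_is_cell[of J I] by auto

section \<open>Dyadic differentiation of the integral\<close>

text \<open>Lebesgue's differentiation theorem for intervals that start at the point. The error is multiplied
  by \<open>h\<close> so that \<open>h = 0\<close> can be included: a point may be the left endpoint of its cell.\<close>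

lemma right_Lebesgue_points:
  fixes g :: "real \<Rightarrow> real"
  assumes "integrable lebesgue g"
  shows "AE x in lebesgue. \<forall>e>0. \<exists>d>0. \<forall>h. 0 \<le> h \<and> h < d \<longrightarrow>
    \<bar>integral {x..x + h} g - h * g x\<bar> \<le> e * h"
proof -
  have "set_integrable lebesgue UNIV g"
    using assms by (simp add: set_integrable_def)
  then have "g integrable_on UNIV" by (rule set_lebesgue_integral_eq_integral)
  then have "g integrable_on cbox a b" for a b
    by (rule integrable_on_subcbox) simp
  then obtain N where N: "negligible N"
    and lim: "\<And>x e. \<lbrakk>x \<notin> N; 0 < e\<rbrakk> \<Longrightarrow> \<exists>d>0. \<forall>h. 0 < h \<and> h < d \<longrightarrow>
      norm (integral (cbox x (x + h *\<^sub>R One)) g /\<^sub>R h ^ DIM(real) - g x) < e"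
    using integrable_ccontinuous_explicit[of g] by metis
  have "AE x in lebesgue. x \<notin> N"
    using N by (simp add: negligible_iff_null_sets AE_not_in)
  then show ?thesis
  proof eventually_elim
    case (elim x)
    show ?case
    proof (intro allI impI)
      fix e :: real assume "0 < e"
      with lim[OF elim] obtain d where "0 < d"
        and d: "\<And>h. 0 < h \<Longrightarrow> h < d \<Longrightarrow> \<bar>integral {x..x + h} g / h - g x\<bar> < e"
        by (force simp: divide_inverse mult.commute)
      have "\<bar>integral {x..x + h} g - h * g x\<bar> \<le> e * h" if "0 \<le> h" "h < d" for h
      proof (cases "h = 0")
        case False
        with that have "0 < h" by simp
        have "\<bar>integral {x..x + h} g - h * g x\<bar> = h * \<bar>integral {x..x + h} g / h - g x\<bar>"
          using \<open>0 < h\<close> by (simp add: abs_mult_pos' right_diff_distrib)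
        with d[OF \<open>0 < h\<close> that(2)] \<open>0 < h\<close> show ?thesis by simp
      qed simp
      with \<open>0 < d\<close> show "\<exists>d>0. \<forall>h. 0 \<le> h \<and> h < d \<longrightarrow>
          \<bar>integral {x..x + h} g - h * g x\<bar> \<le> e * h" by blast
    qed
  qed
qed

lemma AE_lebesgue_uminus:
  fixes P :: "real \<Rightarrow> bool"
  assumes "AE x in lebesgue. P x"
  shows "AE x in lebesgue. P (- x)"
proof -
  obtain N where N: "N \<in> null_sets lebesgue" "{x. \<not> P x} \<subseteq> N"
    using assms by (auto simp: eventually_ae_filter)
  then have "negligible (uminus ` N)"
    by (intro negligible_differentiable_image_negligible)
       (auto simp: negligible_iff_null_sets differentiable_on_def)
  then have "AE x in lebesgue. x \<notin> uminus ` N"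
    by (simp add: negligible_iff_null_sets AE_not_in)
  then show ?thesis
  proof eventually_elim
    case (elim x)
    then have "- x \<notin> N" by (force simp: image_iff)
    with N(2) show ?case by auto
  qed
qed

text \<open>A cell contains \<open>x\<close> without being centred there. Splitting it at \<open>x\<close> leaves an interval to the
  right of \<open>x\<close> and one to the left; the left one becomes a right one after the reflection \<open>x \<mapsto> - x\<close>.
  The two errors are proportional to the lengths of the pieces and therefore add up to an error
  proportional to the length of the cell.\<close>

theorem mean_on_cell_tendsto:
  assumes "integrable_on_ivl f J" "0 < len J"
  shows "AE x in lebesgue. x \<in> pts J \<longrightarrow> (\<lambda>n. mean_on (cell J n x) f) \<longlonglongrightarrow> f x"
proof -
  define g where "g x = indicator (pts J) x *\<^sub>R f x" for x
  have g: "integrable lebesgue g"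
    using assms(1) by (simp add: g_def[abs_def] integrable_on_ivl_def set_integrable_def)
  then have "set_integrable lebesgue UNIV g" by (simp add: set_integrable_def)
  then have "g integrable_on UNIV" by (rule set_lebesgue_integral_eq_integral)
  then have gI: "g integrable_on {c..d}" for c d
    by (metis integrable_on_subinterval subset_UNIV)
  have g': "integrable lebesgue (\<lambda>x. g (- x))"
    using g lebesgue_integrable_real_affine[of g "-1" 0] by simp
  have mean: "len I * mean_on I f = integral {fst I..snd I} g" if "I \<in> dyadic J" for I
  proof -
    have sub: "pts I \<subseteq> pts J" and "0 < len I"
      using dyadic_subset dyadic_len_pos assms(2) that by auto
    have int: "set_integrable lebesgue (pts I) f"
      using integrable_on_ivl_subset[OF assms(1) sub] by (simp add: integrable_on_ivl_def)
    have "integral_on I f = integral (pts I) f"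
      unfolding integral_on_def by (rule set_lebesgue_integral_eq_integral[OF int])
    also have "\<dots> = integral (pts I) g"
      using sub by (intro integral_cong) (auto simp: g_def)
    also have "\<dots> = integral {fst I..snd I} g"
      by (rule integral_subset_negligible)
         (auto simp: pts_def intro: negligible_subset[of "{snd I}"])
    finally show ?thesis using \<open>0 < len I\<close> by (simp add: mean_on_def)
  qed
  show ?thesis
    using right_Lebesgue_points[OF g] AE_lebesgue_uminus[OF right_Lebesgue_points[OF g']]
  proof eventually_elim
    case (elim x)
    show ?case
    proof
      assume x: "x \<in> pts J"
      show "(\<lambda>n. mean_on (cell J n x) f) \<longlonglongrightarrow> f x"
      proof (rule LIMSEQ_I)
        fix e :: real assume "0 < e"
        then have "0 < e / 2" by simp
        obtain d1 where "0 < d1"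
          and d1: "\<And>h. 0 \<le> h \<Longrightarrow> h < d1 \<Longrightarrow> \<bar>integral {x..x + h} g - h * g x\<bar> \<le> e / 2 * h"
          using elim(1) \<open>0 < e / 2\<close> by metis
        obtain d2 where "0 < d2"
          and d2: "\<And>h. 0 \<le> h \<Longrightarrow> h < d2 \<Longrightarrow>
            \<bar>integral {- x..- x + h} (\<lambda>x. g (- x)) - h * g x\<bar> \<le> e / 2 * h"
          using elim(2) \<open>0 < e / 2\<close> by (metis minus_minus)
        have "(\<lambda>n. len J / 2 ^ n) \<longlonglongrightarrow> 0"
          by (intro LIMSEQ_divide_realpow_zero) simp
        then have "\<forall>\<^sub>F n in sequentially. len J / 2 ^ n < min d1 d2"
          using \<open>0 < d1\<close> \<open>0 < d2\<close> by (intro order_tendstoD) auto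
        then obtain n0 where n0: "\<And>n. n \<ge> n0 \<Longrightarrow> len J / 2 ^ n < min d1 d2"
          by (auto simp: eventually_sequentially)
        have "norm (mean_on (cell J n x) f - f x) < e" if "n \<ge> n0" for n
        proof -
          obtain c d where cd: "cell J n x = (c, d)" by fastforce
          have "x \<in> pts (cell J n x)" using mem_cell[OF x] .
          then have x_in: "c \<le> x" "x < d" by (auto simp: cd pts_def)
          have len: "len (cell J n x) = d - c" by (simp add: cd len_def)
          with n0[OF that] len_cell[of J n x] have small: "d - c < d1" "d - c < d2" by auto
          have "(d - c) * mean_on (cell J n x) f = integral {c..d} g"
            using mean[OF cell_dyadic, of n x] len by (simp add: cd)
          also have "\<dots> = integral {c..x} g + integral {x..d} g"
            using x_in gI by (intro Henstock_Kurzweil_Integration.integral_combine[symmetric]) auto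
          finally have split: "(d - c) * mean_on (cell J n x) f = integral {c..x} g + integral {x..d} g" .
          have "\<bar>integral {x..d} g - (d - x) * g x\<bar> \<le> e / 2 * (d - x)"
            using d1[of "d - x"] x_in small by simp
          moreover have "\<bar>integral {c..x} g - (x - c) * g x\<bar> \<le> e / 2 * (x - c)"
            using d2[of "x - c"] x_in small
              Henstock_Kurzweil_Integration.integral_reflect_real[of x c g] by simp
          ultimately have "\<bar>(d - c) * mean_on (cell J n x) f - (d - c) * g x\<bar> \<le> e / 2 * (d - c)"
            unfolding split abs_le_iff by (simp add: algebra_simps)
          then have "(d - c) * \<bar>mean_on (cell J n x) f - g x\<bar> \<le> (d - c) * (e / 2)"
            using x_in by (simp add: right_diff_distrib[symmetric] abs_mult del: right_diff_distrib' left_diff_distrib')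
          then have "\<bar>mean_on (cell J n x) f - g x\<bar> \<le> e / 2"
            using x_in by (simp add: mult_le_cancel_left_pos)
          moreover have "g x = f x" using x by (simp add: g_def)
          ultimately show ?thesis using \<open>0 < e\<close> by simp
        qed
        then show "\<exists>n0. \<forall>n\<ge>n0. norm (mean_on (cell J n x) f - f x) < e" by blast
      qed
    qed
  qed
qed

section \<open>The partial products\<close>

locale weight_on_interval =
  fixes J :: ivl and w :: "real \<Rightarrow> real"
  assumes len_J: "0 < len J" and weight: "is_weight J w"
begin

lemma integrable_w: "I \<in> dyadic J \<Longrightarrow> integrable_on_ivl w I"
  using weight dyadic_subset[OF len_J, of I] integrable_on_ivl_subset[of w J I]
  by (simp add: is_weight_def)

lemma weight_on_dyadic: "I \<in> dyadic J \<Longrightarrow> is_weight I w"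
  using weight dyadic_subset[OF len_J] by (rule is_weight_subset)

lemma mean_w_pos: "I \<in> dyadic J \<Longrightarrow> 0 < mean_on I w"
  using dyadic_len_pos[OF len_J] weight_on_dyadic by (intro mean_on_pos)

text \<open>The Haar coefficient is normalized so that for \<open>l = 1\<close> the factor of \<open>I\<close> at \<open>x\<close> is the ratio of the
  mean of \<open>w\<close> over the half containing \<open>x\<close> to the mean over \<open>I\<close>; general \<open>l\<close> interpolates linearly
  between this ratio and \<open>1\<close>.\<close>

lemma haar_factor:
  assumes I: "I \<in> dyadic J" and x: "x \<in> pts I"
  shows "1 + l * b_coeff J w I * haar I x = 1 - l + l * (mean_on (child I x) w / mean_on I w)"
proof -
  define L R where "L = integral_on (left_half I) w" and "R = integral_on (right_half I) w"
  have len: "0 < len I" using dyadic_len_pos[OF len_J I] .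
  have sub: "pts (left_half I) \<subseteq> pts J" "pts (right_half I) \<subseteq> pts J"
    using dyadic_subset[OF len_J dyadic.left[OF I]] dyadic_subset[OF len_J dyadic.right[OF I]] by auto
  have int: "integrable_on_ivl w (left_half I)" "integrable_on_ivl w (right_half I)"
    using I by (auto intro: integrable_w dyadic.intros)
  have "pairing J w (haar I) = (LINT x|lebesgue. len I powr (- 1 / 2) *
      (indicator (pts (right_half I)) x *\<^sub>R w x - indicator (pts (left_half I)) x *\<^sub>R w x))"
    unfolding pairing_def integral_on_def set_lebesgue_integral_def haar_def
    using sub by (intro Bochner_Integration.integral_cong) (auto simp: indicator_def)
  also have "\<dots> = len I powr (- 1 / 2) * (R - L)"
    using int
    by (simp add: L_def R_def integral_on_def set_lebesgue_integral_def integrable_on_ivl_def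
        set_integrable_def)
  finally have pairing: "pairing J w (haar I) = len I powr (- 1 / 2) * (R - L)" .
  have sq: "len I powr (- 1 / 2) * len I powr (- 1 / 2) = 1 / len I"
    unfolding powr_add[symmetric] using len by (simp add: powr_neg_one)
  have sum: "L + R = mean_on I w * len I"
    using integral_on_halves[OF len integrable_w[OF I]] len by (simp add: L_def R_def mean_on_def)
  have mL: "mean_on (left_half I) w = 2 * L / len I" and mR: "mean_on (right_half I) w = 2 * R / len I"
    by (simp_all add: mean_on_def len_halves L_def R_def)
  have m: "0 < mean_on I w" by (rule mean_w_pos[OF I])
  have factor: ?thesis if "b_coeff J w I * haar I x = mean_on (child I x) w / mean_on I w - 1"
    unfolding mult.assoc that by (simp add: right_diff_distrib)
  consider "x \<in> pts (left_half I)" "x \<notin> pts (right_half I)"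
    | "x \<in> pts (right_half I)" "x \<notin> pts (left_half I)"
    using pts_halves[OF len] x by blast
  then show ?thesis
  proof cases
    case 1
    have "b_coeff J w I * haar I x =
        - (len I powr (- 1 / 2) * len I powr (- 1 / 2)) * (R - L) / mean_on I w"
      using 1 by (simp add: b_coeff_def pairing haar_def)
    also have "\<dots> = (L - R) / (len I * mean_on I w)"
      unfolding sq by (simp add: diff_divide_distrib)
    also have "\<dots> = mean_on (left_half I) w / mean_on I w - 1"
      using sum m len by (simp add: mL field_simps)
    finally show ?thesis using 1 by (intro factor) (simp add: child_eq)
  next
    case 2
    have "b_coeff J w I * haar I x =
        (len I powr (- 1 / 2) * len I powr (- 1 / 2)) * (R - L) / mean_on I w"
      using 2 by (simp add: b_coeff_def pairing haar_def)
    also have "\<dots> = (R - L) / (len I * mean_on I w)"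
      unfolding sq by (simp add: field_simps)
    also have "\<dots> = mean_on (right_half I) w / mean_on I w - 1"
      using sum m len by (simp add: mR field_simps)
    finally show ?thesis using 2 by (intro factor) (simp add: child_eq)
  qed
qed

text \<open>Haar functions of intervals that do not contain \<open>x\<close> vanish at \<open>x\<close>, so only the branch of \<open>x\<close>
  contributes.\<close>

lemma lambda_partial_eq_prod:
  assumes x: "x \<in> pts J"
  shows "lambda_partial J w l n x =
    (\<Prod>k<n. 1 - l + l * (mean_on (cell J (Suc k) x) w / mean_on (cell J k x) w))"
proof -
  let ?S = "{I. I \<in> dyadic J \<and> len I > len J / 2 ^ n}"
  let ?F = "\<lambda>I. 1 + l * b_coeff J w I * haar I x"
  have len_iff: "len J / 2 ^ n < len J / 2 ^ m \<longleftrightarrow> m < n" for m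
    using len_J by (simp add: field_simps)
  have cells: "{I \<in> ?S. x \<in> pts I} = (\<lambda>k. cell J k x) ` {..<n}"
  proof (intro set_eqI iffI)
    fix I assume "I \<in> {I \<in> ?S. x \<in> pts I}"
    moreover from this obtain m where "len I = len J / 2 ^ m" "cell J m x = I"
      using dyadic_is_cell[OF len_J, of I] by blast
    ultimately show "I \<in> (\<lambda>k. cell J k x) ` {..<n}"
      using len_iff by auto
  next
    fix I assume "I \<in> (\<lambda>k. cell J k x) ` {..<n}"
    then show "I \<in> {I \<in> ?S. x \<in> pts I}"
      using len_iff mem_cell[OF x] by (auto simp: cell_dyadic len_cell)
  qed
  have inj: "inj_on (\<lambda>k. cell J k x) {..<n}"
  proof (rule inj_onI)
    fix i j assume "cell J i x = cell J j x"
    then have "len J / 2 ^ i = len J / 2 ^ j" by (metis len_cell)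
    then show "i = j" using len_J by (simp add: field_simps)
  qed
  have "lambda_partial J w l n x = (\<Prod>I\<in>{I \<in> ?S. x \<in> pts I}. ?F I)"
    unfolding lambda_partial_def
  proof (rule prod.mono_neutral_right)
    show "finite ?S" using finite_dyadic_len_gt[OF len_J, of n] by simp
    show "\<forall>I\<in>?S - {I \<in> ?S. x \<in> pts I}. ?F I = 1"
    proof
      fix I assume "I \<in> ?S - {I \<in> ?S. x \<in> pts I}"
      then have "x \<notin> pts I" "0 < len I" using dyadic_len_pos[OF len_J] by auto
      then have "haar I x = 0" using pts_halves[of I] by (simp add: haar_def)
      then show "?F I = 1" by simp
    qed
  qed auto
  also have "\<dots> = (\<Prod>k<n. ?F (cell J k x))"
    unfolding cells by (simp add: prod.reindex[OF inj])
  also have "\<dots> = (\<Prod>k<n. 1 - l + l * (mean_on (cell J (Suc k) x) w / mean_on (cell J k x) w))"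
    unfolding haar_factor[OF cell_dyadic mem_cell[OF x]] by simp
  finally show ?thesis .
qed

lemma lambda_partial_Suc:
  "x \<in> pts J \<Longrightarrow> lambda_partial J w l (Suc n) x =
    lambda_partial J w l n x * (1 - l + l * (mean_on (cell J (Suc n) x) w / mean_on (cell J n x) w))"
  by (simp add: lambda_partial_eq_prod)

lemma lambda_partial_pos:
  assumes "x \<in> pts J" "0 \<le> l" "l \<le> 1"
  shows "0 < lambda_partial J w l n x"
  unfolding lambda_partial_eq_prod[OF assms(1)]
  using assms by (intro prod_pos affine_ratio_pos divide_pos_pos mean_w_pos cell_dyadic ballI)

lemma lambda_partial_measurable [measurable]: "lambda_partial J w l n \<in> borel_measurable lebesgue"
proof -
  have [measurable]: "haar I \<in> borel_measurable lebesgue" for I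
    unfolding haar_def by measurable
  show ?thesis unfolding lambda_partial_def by measurable
qed

text \<open>The value \<open>c\<close> of the partial product over the proper ancestors of \<open>I\<close> is the mean over \<open>I\<close> of every
  later partial product, and it stands in for the mean of the limit. A relation is more convenient than a function of \<open>I\<close>, as it passes to the halves
  by one multiplication.\<close>

definition node :: "real \<Rightarrow> nat \<Rightarrow> ivl \<Rightarrow> real \<Rightarrow> bool" where
  "node l m I c \<longleftrightarrow> I \<in> dyadic J \<and>
     (\<forall>x\<in>pts I. cell J m x = I \<and> lambda_partial J w l m x = c)"

lemma node_child:
  assumes node: "node l m I c"
  shows "node l (Suc m) (left_half I) (c * (1 - l + l * (mean_on (left_half I) w / mean_on I w)))"
    and "node l (Suc m) (right_half I) (c * (1 - l + l * (mean_on (right_half I) w / mean_on I w)))"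
proof -
  have I: "I \<in> dyadic J" and const: "\<forall>x\<in>pts I. cell J m x = I \<and> lambda_partial J w l m x = c"
    using node by (auto simp: node_def)
  have sub: "pts I = pts (left_half I) \<union> pts (right_half I)" "pts I \<subseteq> pts J"
    using pts_halves[of I] dyadic_len_pos[OF len_J I] dyadic_subset[OF len_J I] by auto
  show "node l (Suc m) (left_half I) (c * (1 - l + l * (mean_on (left_half I) w / mean_on I w)))"
    using const sub I by (auto simp: node_def child_eq lambda_partial_Suc subset_iff intro: dyadic.left)
  show "node l (Suc m) (right_half I) (c * (1 - l + l * (mean_on (right_half I) w / mean_on I w)))"
    using const sub I by (auto simp: node_def child_eq lambda_partial_Suc subset_iff intro: dyadic.right)
qed

lemma dyadic_is_node: "I \<in> dyadic J \<Longrightarrow> \<exists>m c. node l m I c"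
proof (induction rule: dyadic.induct)
  case root
  have "node l 0 J 1"
    by (simp add: node_def dyadic.root lambda_partial_eq_prod)
  then show ?case by blast
next
  case (left I)
  then show ?case using node_child(1) by blast
next
  case (right I)
  then show ?case using node_child(2) by blast
qed

lemma node_dyadic: "node l m I c \<Longrightarrow> I \<in> dyadic J"
  by (simp add: node_def)

lemma node_pos:
  assumes "node l m I c" "0 \<le> l" "l \<le> 1"
  shows "0 < c"
proof -
  have "I \<in> dyadic J" using assms(1) by (rule node_dyadic)
  then have "fst I \<in> pts I" "fst I \<in> pts J"
    using dyadic_len_pos[OF len_J, of I] dyadic_subset[OF len_J, of I] by (force simp: pts_def len_def)+
  with assms lambda_partial_pos[of "fst I" l m] show ?thesis by (simp add: node_def)
qed

text \<open>Over the two halves of an interval the ratios of the means add up to \<open>2\<close>, hence so do the factors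
  \<open>1 - l + l u\<close>: the partial products form a martingale. The induction runs on the number \<open>k\<close> of
  remaining generations, for all nodes simultaneously.\<close>

lemma lambda_partial_martingale:
  assumes "node l m I c"
  shows "integrable_on_ivl (lambda_partial J w l (m + k)) I \<and>
    integral_on I (lambda_partial J w l (m + k)) = c * len I"
  using assms
proof (induction k arbitrary: m I c)
  case 0
  have eq: "x \<in> pts I \<Longrightarrow> lambda_partial J w l m x = c" for x
    using 0 by (simp add: node_def)
  have len: "0 < len I" using dyadic_len_pos[OF len_J node_dyadic[OF 0]] .
  have "integrable_on_ivl (lambda_partial J w l m) I = integrable_on_ivl (\<lambda>_. c) I"
    unfolding integrable_on_ivl_def by (rule set_integrable_cong) (auto simp: eq)
  moreover have "integral_on I (lambda_partial J w l m) = integral_on I (\<lambda>_. c)"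
    unfolding integral_on_def by (rule set_lebesgue_integral_cong) (auto simp: eq)
  ultimately show ?case
    using len integrable_on_ivl_const integral_on_const by simp
next
  case (Suc k)
  let ?P = "lambda_partial J w l (m + Suc k)"
  have I: "I \<in> dyadic J" using Suc.prems by (rule node_dyadic)
  have len: "0 < len I" using dyadic_len_pos[OF len_J I] .
  have left: "integrable_on_ivl ?P (left_half I)"
      "integral_on (left_half I) ?P = c * (1 - l + l * (mean_on (left_half I) w / mean_on I w)) * (len I / 2)"
    using Suc.IH[OF node_child(1)[OF Suc.prems]] by (simp_all add: len_halves)
  have right: "integrable_on_ivl ?P (right_half I)"
      "integral_on (right_half I) ?P = c * (1 - l + l * (mean_on (right_half I) w / mean_on I w)) * (len I / 2)"
    using Suc.IH[OF node_child(2)[OF Suc.prems]] by (simp_all add: len_halves)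
  have int: "integrable_on_ivl ?P I"
    unfolding integrable_on_ivl_def pts_halves(1)[OF len]
    using left(1) right(1) by (intro set_integrable_Un) (simp_all add: integrable_on_ivl_def)
  have m: "0 < mean_on I w" using mean_w_pos[OF I] .
  have "mean_on (left_half I) w / mean_on I w + mean_on (right_half I) w / mean_on I w = 2"
    using mean_on_halves[OF len integrable_w[OF I]] m by (simp add: field_simps)
  then have mr: "mean_on (right_half I) w / mean_on I w = 2 - mean_on (left_half I) w / mean_on I w"
    by simp
  have "integral_on I ?P = c * len I"
    unfolding integral_on_halves[OF len int] left(2) right(2) mr by (simp add: field_simps)
  with int show ?case by simp
qed
section \<open>The limit weight\<close>

text \<open>One step multiplies the quotient by \<open>(1 - l + l u) / u\<^sup>l\<close>, which is at least \<open>1\<close> by Bernoulli's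
  inequality.\<close>

lemma lambda_partial_ratio_incseq:
  assumes x: "x \<in> pts J" and l: "0 \<le> l" "l \<le> 1"
  shows "incseq (\<lambda>n. lambda_partial J w l n x / mean_on (cell J n x) w powr l)"
proof (rule incseq_SucI)
  fix n
  let ?P = "lambda_partial J w l" and ?m = "\<lambda>n. mean_on (cell J n x) w"
  have m: "0 < ?m n" for n by (rule mean_w_pos[OF cell_dyadic])
  have "?P n x / ?m n powr l = ?P n x * (?m (Suc n) / ?m n) powr l / ?m (Suc n) powr l"
    using m[of n] m[of "Suc n"] by (simp add: powr_divide less_imp_le)
  also have "\<dots> \<le> ?P n x * (1 - l + l * (?m (Suc n) / ?m n)) / ?m (Suc n) powr l"
    using m[of n] m[of "Suc n"] l lambda_partial_pos[OF x l, of n]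
    by (intro divide_right_mono mult_left_mono powr_le_affine divide_pos_pos) auto
  also have "\<dots> = ?P (Suc n) x / ?m (Suc n) powr l"
    by (simp only: lambda_partial_Suc[OF x])
  finally show "?P n x / ?m n powr l \<le> ?P (Suc n) x / ?m (Suc n) powr l" .
qed

text \<open>Convergence comes from the increasing quotients \<open>R n\<close>. The means of \<open>w\<close> along the branch converge
  to \<open>w x > 0\<close>; if \<open>R\<close> were unbounded at \<open>x\<close>, the partial products would tend to infinity, and since
  their integrals are all equal, Fatou's lemma excludes this for almost every \<open>x\<close>. As \<open>R\<close> increases
  to its limit, each \<open>R n\<close> also gives a lower bound for the limit of the products.\<close>

lemma lambda_partial_tendsto:
  assumes l: "0 \<le> l" "l \<le> 1"
  shows "AE x in lebesgue. x \<in> pts J \<longrightarrow>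
    (\<lambda>n. lambda_partial J w l n x) \<longlonglongrightarrow> lambda_op J w l x \<and>
    (\<forall>n. lambda_partial J w l n x * (w x / mean_on (cell J n x) w) powr l \<le> lambda_op J w l x)"
proof -
  let ?P = "lambda_partial J w l"
  have "node l 0 J 1"
    by (simp add: node_def dyadic.root lambda_partial_eq_prod)
  note mart = lambda_partial_martingale[OF this]
  have no_blowup: "AE x in lebesgue. x \<in> pts J \<longrightarrow> \<not> filterlim (\<lambda>n. ?P n x) at_top sequentially"
  proof (rule Fatou_set_integral(1))
    show "set_integrable lebesgue (pts J) (?P n)" for n
      using mart[of n] by (simp add: integrable_on_ivl_def)
    show "(LINT x:pts J|lebesgue. ?P n x) \<le> len J" for n
      using mart[of n] by (simp add: integral_on_def)
    show "0 \<le> ?P n x" if "x \<in> pts J" for n x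
      using lambda_partial_pos[OF that l] by (rule less_imp_le)
  qed
  have "integrable_on_ivl w J" and pos: "AE x in lebesgue. x \<in> pts J \<longrightarrow> 0 < w x"
    using weight by (auto simp: is_weight_def)
  note diff = mean_on_cell_tendsto[OF this(1) len_J]
  show ?thesis
    using no_blowup pos diff
  proof eventually_elim
    case (elim x)
    show ?case
    proof
      assume x: "x \<in> pts J"
      define m where "m n = mean_on (cell J n x) w" for n
      define R where "R n = ?P n x / m n powr l" for n
      have m: "0 < m n" for n unfolding m_def by (rule mean_w_pos[OF cell_dyadic])
      have P_eq: "?P n x = m n powr l * R n" for n using m[of n] by (simp add: R_def)
      have w: "0 < w x" and lim_m: "m \<longlonglongrightarrow> w x"
        and blow: "\<not> filterlim (\<lambda>n. ?P n x) at_top sequentially"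
        using elim x by (auto simp: m_def[abs_def])
      have lim_ml: "(\<lambda>n. m n powr l) \<longlonglongrightarrow> w x powr l"
        using lim_m w by (intro tendsto_powr tendsto_const) auto
      have R: "incseq R"
        unfolding R_def m_def by (rule lambda_partial_ratio_incseq[OF x l])
      have "\<exists>B. \<forall>n. R n \<le> B"
      proof (rule ccontr)
        assume "\<not> (\<exists>B. \<forall>n. R n \<le> B)"
        then have "\<exists>n. B \<le> R n" for B by (meson linear)
        then have "filterlim R at_top sequentially"
          unfolding filterlim_at_top eventually_sequentially
          using R by (meson incseqD order_trans)
        then have "filterlim (\<lambda>n. m n powr l * R n) at_top sequentially"
          using w by (intro filterlim_tendsto_pos_mult_at_top[OF lim_ml]) simp_all
        with blow show False by (simp add: P_eq)
      qed
      then obtain B where "\<forall>n. R n \<le> B" by blast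
      then obtain L where L: "R \<longlonglongrightarrow> L" "\<forall>n. R n \<le> L"
        using incseq_convergent[OF R] by blast
      have lim_P: "(\<lambda>n. ?P n x) \<longlonglongrightarrow> w x powr l * L"
        unfolding P_eq by (intro tendsto_mult lim_ml L)
      then have W: "lambda_op J w l x = w x powr l * L"
        unfolding lambda_op_def by (rule limI)
      have "?P n x * (w x / m n) powr l \<le> w x powr l * L" for n
      proof -
        have "?P n x * (w x / m n) powr l = w x powr l * R n"
          using w m[of n] by (simp add: powr_divide less_imp_le R_def)
        also have "\<dots> \<le> w x powr l * L"
          using L by (intro mult_left_mono) auto
        finally show ?thesis .
      qed
      with lim_P show "(\<lambda>n. ?P n x) \<longlonglongrightarrow> lambda_op J w l x \<and>
          (\<forall>n. ?P n x * (w x / mean_on (cell J n x) w) powr l \<le> lambda_op J w l x)"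
        by (simp add: W m_def)
    qed
  qed
qed

lemma lambda_op_measurable [measurable]: "lambda_op J w l \<in> borel_measurable lebesgue"
  unfolding lambda_op_def by measurable

text \<open>Relative to an interval, the modified weight dominates the \<open>l\<close>-th power of the original one.
  Together with the upper bound \<open>c\<close> for its mean, this is all that the three conditions use.\<close>

lemma lambda_op_ge_on_node:
  assumes "node l m I c" "0 \<le> l" "l \<le> 1"
  shows "AE x in lebesgue. x \<in> pts I \<longrightarrow>
    0 < w x \<and> c * (w x / mean_on I w) powr l \<le> lambda_op J w l x"
proof -
  have sub: "pts I \<subseteq> pts J" using dyadic_subset[OF len_J node_dyadic[OF assms(1)]] .
  have "AE x in lebesgue. x \<in> pts J \<longrightarrow> 0 < w x"
    using weight by (simp add: is_weight_def)
  with lambda_partial_tendsto[OF assms(2,3)] show ?thesis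
  proof eventually_elim
    case (elim x)
    show ?case
    proof
      assume x: "x \<in> pts I"
      then have "cell J m x = I" "lambda_partial J w l m x = c"
        using assms(1) by (auto simp: node_def)
      with elim sub x show "0 < w x \<and> c * (w x / mean_on I w) powr l \<le> lambda_op J w l x"
        by auto
    qed
  qed
qed

text \<open>From generation \<open>m\<close> on, all partial products have the mean \<open>c\<close> over \<open>I\<close>; Fatou's lemma passes this
  to the limit as an inequality.\<close>

lemma lambda_op_mean_le_on_node:
  assumes "node l m I c" "0 \<le> l" "l \<le> 1"
  shows "integrable_on_ivl (lambda_op J w l) I" "mean_on I (lambda_op J w l) \<le> c"
proof -
  have sub: "pts I \<subseteq> pts J" and len: "0 < len I"
    using dyadic_subset[OF len_J node_dyadic[OF assms(1)]]
      dyadic_len_pos[OF len_J node_dyadic[OF assms(1)]] .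
  note mart = lambda_partial_martingale[OF assms(1)]
  have "set_integrable lebesgue (pts I) (lambda_op J w l) \<and>
      (LINT x:pts I|lebesgue. lambda_op J w l x) \<le> c * len I"
  proof (rule Fatou_set_integral(2))
    show "set_integrable lebesgue (pts I) (lambda_partial J w l (m + k))" for k
      using mart[of k] by (simp add: integrable_on_ivl_def)
    show "(LINT x:pts I|lebesgue. lambda_partial J w l (m + k) x) \<le> c * len I" for k
      using mart[of k] by (simp add: integral_on_def)
    show "0 \<le> lambda_partial J w l (m + k) x" if "x \<in> pts I" for k x
      using lambda_partial_pos[OF _ assms(2,3)] sub that by (meson less_imp_le subsetD)
    show "(\<lambda>x. indicator (pts I) x *\<^sub>R lambda_op J w l x) \<in> borel_measurable lebesgue"
      by measurable
    show "AE x in lebesgue. x \<in> pts I \<longrightarrow>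
        (\<lambda>k. lambda_partial J w l (m + k) x) \<longlonglongrightarrow> lambda_op J w l x"
      using lambda_partial_tendsto[OF assms(2,3)]
    proof eventually_elim
      case (elim x)
      then show ?case
        using sub LIMSEQ_ignore_initial_segment[of "\<lambda>n. lambda_partial J w l n x" _ m]
        by (auto simp: add.commute)
    qed
  qed
  then show "integrable_on_ivl (lambda_op J w l) I" "mean_on I (lambda_op J w l) \<le> c"
    using len by (auto simp: integrable_on_ivl_def mean_on_def integral_on_def field_simps)
qed

lemma lambda_op_is_weight:
  assumes "0 \<le> l" "l \<le> 1"
  shows "is_weight J (lambda_op J w l)"
proof -
  obtain m c where node: "node l m J c" using dyadic_is_node[OF dyadic.root] by blast
  have "AE x in lebesgue. x \<in> pts J \<longrightarrow> 0 < lambda_op J w l x"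
    using lambda_op_ge_on_node[OF node assms]
  proof eventually_elim
    case (elim x)
    show ?case
    proof
      assume "x \<in> pts J"
      then have "0 < w x" "c * (w x / mean_on J w) powr l \<le> lambda_op J w l x"
        using elim by auto
      moreover from this(1) have "0 < c * (w x / mean_on J w) powr l"
        using node_pos[OF node assms] mean_w_pos[OF dyadic.root] by simp
      ultimately show "0 < lambda_op J w l x" by linarith
    qed
  qed
  then show ?thesis
    using lambda_op_mean_le_on_node[OF node assms] by (simp add: is_weight_def)
qed

text \<open>Average the logarithm of the pointwise lower bound. The conclusion bounds \<open>c\<close> rather than the mean
  of the modified weight: as \<open>c\<close> dominates that mean, this yields the limiting condition, and by
  Jensen's inequality it also shows that \<open>c\<close> and the mean are comparable, which doubling needs.\<close>

lemma lambda_op_exp_mean_ln: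
  assumes node: "node l m I c" and l: "0 \<le> l" "l \<le> 1"
    and int: "integrable_on_ivl (\<lambda>x. ln (w x)) I"
    and bound: "mean_on I w \<le> C * exp (mean_on I (\<lambda>x. ln (w x)))"
  shows "integrable_on_ivl (\<lambda>x. ln (lambda_op J w l x)) I"
    and "c \<le> C powr l * exp (mean_on I (\<lambda>x. ln (lambda_op J w l x)))"
proof -
  let ?W = "lambda_op J w l"
  have I: "I \<in> dyadic J" using node by (rule node_dyadic)
  have len: "0 < len I" and m: "0 < mean_on I w" and c: "0 < c"
    using dyadic_len_pos[OF len_J I] mean_w_pos[OF I] node_pos[OF node l] .
  \<comment> \<open>\<open>\<alpha> + l ln w\<close> is the logarithm of the lower bound \<open>c (w / m)\<^sup>l\<close>.\<close>
  define \<alpha> where "\<alpha> = ln c - l * ln (mean_on I w)"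
  have W: "integrable_on_ivl ?W I" using lambda_op_mean_le_on_node[OF node l] by simp
  have ge: "AE x in lebesgue. x \<in> pts I \<longrightarrow> 0 < ?W x \<and> \<alpha> + l * ln (w x) \<le> ln (?W x)"
    using lambda_op_ge_on_node[OF node l]
  proof eventually_elim
    case (elim x)
    show ?case
    proof
      assume "x \<in> pts I"
      then have w: "0 < w x" and le: "c * (w x / mean_on I w) powr l \<le> ?W x"
        using elim by auto
      have pos: "0 < c * (w x / mean_on I w) powr l" using c w m by simp
      have "\<alpha> + l * ln (w x) = ln (c * (w x / mean_on I w) powr l)"
        using c w m by (simp add: \<alpha>_def ln_mult ln_powr ln_div algebra_simps)
      also have "\<dots> \<le> ln (?W x)" using pos le by simp
      finally show "0 < ?W x \<and> \<alpha> + l * ln (w x) \<le> ln (?W x)" using pos le by linarith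
    qed
  qed
  show int_W: "integrable_on_ivl (\<lambda>x. ln (?W x)) I"
  proof (rule integrable_on_ivl_bound)
    show "integrable_on_ivl (\<lambda>x. (\<bar>\<alpha>\<bar> + l * \<bar>ln (w x)\<bar>) + ?W x) I"
      using integrable_on_ivl_affine[of "\<lambda>x. \<bar>ln (w x)\<bar>" I "\<bar>\<alpha>\<bar>" l]
        set_integrable_abs[OF int[unfolded integrable_on_ivl_def]] W
      unfolding integrable_on_ivl_def by (intro set_integral_add(1)[where g = ?W]) auto
    show "(\<lambda>x. indicator (pts I) x *\<^sub>R ln (?W x)) \<in> borel_measurable lebesgue"
      by measurable
    show "AE x in lebesgue. x \<in> pts I \<longrightarrow> \<bar>ln (?W x)\<bar> \<le> (\<bar>\<alpha>\<bar> + l * \<bar>ln (w x)\<bar>) + ?W x"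
      using ge
    proof eventually_elim
      case (elim x)
      show ?case
      proof
        assume "x \<in> pts I"
        then have W: "0 < ?W x" "\<alpha> + l * ln (w x) \<le> ln (?W x)" using elim by auto
        have "ln (?W x) < ?W x" using W(1) by (rule ln_less_self)
        moreover have "\<bar>l * ln (w x)\<bar> = l * \<bar>ln (w x)\<bar>" using l by (simp add: abs_mult)
        ultimately show "\<bar>ln (?W x)\<bar> \<le> (\<bar>\<alpha>\<bar> + l * \<bar>ln (w x)\<bar>) + ?W x"
          using W by linarith
      qed
    qed
  qed
  have C: "0 < C"
    using m bound by (smt (verit) exp_gt_zero mult_nonpos_nonneg)
  have "AE x in lebesgue. x \<in> pts I \<longrightarrow> \<alpha> + l * ln (w x) \<le> ln (?W x)"
    using ge by eventually_elim auto
  then have mean: "\<alpha> + l * mean_on I (\<lambda>x. ln (w x)) \<le> mean_on I (\<lambda>x. ln (?W x))"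
    by (rule mean_on_ge_affine[OF len int_W int])
  have "ln (mean_on I w) \<le> ln (C * exp (mean_on I (\<lambda>x. ln (w x))))"
    using m bound by simp
  also have "\<dots> = ln C + mean_on I (\<lambda>x. ln (w x))"
    using C by (simp add: ln_mult)
  finally have "l * ln (mean_on I w) \<le> l * (ln C + mean_on I (\<lambda>x. ln (w x)))"
    using l by (intro mult_left_mono)
  with mean have "ln c \<le> l * ln C + mean_on I (\<lambda>x. ln (?W x))"
    by (simp add: \<alpha>_def algebra_simps)
  then have "exp (ln c) \<le> exp (l * ln C + mean_on I (\<lambda>x. ln (?W x)))" by simp
  then show "c \<le> C powr l * exp (mean_on I (\<lambda>x. ln (?W x)))"
    using c C by (simp add: exp_add powr_def)
qed

section \<open>Stability of the conditions\<close>

lemma lambda_op_A_infty_cond: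
  assumes l: "0 \<le> l" "l \<le> 1" and A: "A_infty_cond J w"
  shows "A_infty_cond J (lambda_op J w l)"
proof -
  obtain C where C: "\<And>I. I \<in> dyadic J \<Longrightarrow> integrable_on_ivl (\<lambda>x. ln (w x)) I \<and>
      mean_on I w \<le> C * exp (mean_on I (\<lambda>x. ln (w x)))"
    using A by (auto simp: A_infty_cond_def)
  have "integrable_on_ivl (\<lambda>x. ln (lambda_op J w l x)) I \<and> mean_on I (lambda_op J w l) \<le>
      C powr l * exp (mean_on I (\<lambda>x. ln (lambda_op J w l x)))" if I: "I \<in> dyadic J" for I
  proof -
    obtain m c where node: "node l m I c" using dyadic_is_node[OF I] by blast
    show ?thesis
      using lambda_op_mean_le_on_node(2)[OF node l] lambda_op_exp_mean_ln[OF node l] C[OF I]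
      by (meson order_trans)
  qed
  then show ?thesis unfolding A_infty_cond_def by blast
qed

text \<open>The values \<open>c'\<close> of the parent and \<open>c\<close> of the child differ by the factor \<open>1 - l + l u \<ge> u\<^sup>l\<close>, and
  doubling of \<open>w\<close> bounds \<open>u\<close> from below by \<open>2 / D\<close>. Comparability of these values with the means of
  the modified weight then transfers doubling to it.\<close>

lemma lambda_op_doubling:
  assumes l: "0 \<le> l" "l \<le> 1" and A_infty: "A_infty_cond J w"
    and doubling: "dyadic_doubling J w"
  shows "dyadic_doubling J (lambda_op J w l)"
proof -
  let ?W = "lambda_op J w l"
  obtain A where A: "\<And>I. I \<in> dyadic J \<Longrightarrow> integrable_on_ivl (\<lambda>x. ln (w x)) I \<and>
      mean_on I w \<le> A * exp (mean_on I (\<lambda>x. ln (w x)))"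
    using A_infty by (auto simp: A_infty_cond_def)
  obtain D where D: "\<And>I I'. I \<in> dyadic J \<Longrightarrow> I' \<in> dyadic J \<Longrightarrow> is_parent I' I \<Longrightarrow>
      integral_on I' w \<le> D * integral_on I w"
    using doubling by (auto simp: dyadic_doubling_def)
  have "integral_on I' ?W \<le> (2 * (D / 2) powr l * A powr l) * integral_on I ?W"
    if I: "I \<in> dyadic J" and I': "I' \<in> dyadic J" and parent: "is_parent I' I" for I I'
  proof -
    obtain m c' where node': "node l m I' c'" using dyadic_is_node[OF I'] by blast
    define u where "u = mean_on I w / mean_on I' w"
    define c where "c = c' * (1 - l + l * u)"
    have node: "node l (Suc m) I c"
      using parent node_child[OF node'] by (auto simp: is_parent_def u_def c_def)
    have len': "0 < len I'" using dyadic_len_pos[OF len_J I'] .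
    have len: "len I = len I' / 2" using parent by (auto simp: is_parent_def len_halves)
    have means: "0 < mean_on I w" "0 < mean_on I' w" using mean_w_pos I I' by auto
    have c': "0 < c'" using node_pos[OF node' l] .
    have "mean_on I' w \<le> D / 2 * mean_on I w"
      using D[OF I I' parent] len len' by (simp add: integral_on_eq_mean_on field_simps)
    then have Du: "1 \<le> D / 2 * u"
      using means by (simp add: u_def field_simps)
    have u: "0 < u" using means by (simp add: u_def)
    with Du have Dpos: "0 < D" by (smt (verit) half_gt_zero_iff mult_nonpos_nonneg)
    \<comment> \<open>\<open>D / 2 * u \<ge> 1\<close> gives \<open>(D / 2)\<^sup>l (1 - l + l u) \<ge> (D / 2 * u)\<^sup>l \<ge> 1\<close>.\<close>
    have "1 \<le> (D / 2 * u) powr l" using Du l by (simp add: ge_one_powr_ge_zero)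
    also have "\<dots> = (D / 2) powr l * u powr l" by (rule powr_mult)
    also have "\<dots> \<le> (D / 2) powr l * (1 - l + l * u)"
      using powr_le_affine[OF u l] by (intro mult_left_mono) auto
    finally have "c' * 1 \<le> c' * ((D / 2) powr l * (1 - l + l * u))"
      using c' by (intro mult_left_mono) auto
    then have c'_le: "c' \<le> (D / 2) powr l * c" by (simp add: c_def algebra_simps)
    have ln_int: "integrable_on_ivl (\<lambda>x. ln (?W x)) I"
      and c_le: "c \<le> A powr l * exp (mean_on I (\<lambda>x. ln (?W x)))"
      using lambda_op_exp_mean_ln[OF node l] A[OF I] by auto
    have W: "is_weight I ?W"
      using lambda_op_is_weight[OF l] dyadic_subset[OF len_J I] by (rule is_weight_subset)
    have "mean_on I (\<lambda>x. ln (?W x)) \<le> ln (mean_on I ?W)"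
      using mean_on_ln_le[OF _ W ln_int] len len' by simp
    then have "exp (mean_on I (\<lambda>x. ln (?W x))) \<le> mean_on I ?W"
      using mean_on_pos[OF _ W] len len' by (simp add: ln_ge_iff)
    then have "A powr l * exp (mean_on I (\<lambda>x. ln (?W x))) \<le> A powr l * mean_on I ?W"
      by (intro mult_left_mono) auto
    with c_le have "c \<le> A powr l * mean_on I ?W" by linarith
    then have "(D / 2) powr l * c \<le> (D / 2) powr l * (A powr l * mean_on I ?W)"
      by (intro mult_left_mono) auto
    with c'_le lambda_op_mean_le_on_node(2)[OF node' l]
    have "mean_on I' ?W \<le> (D / 2) powr l * (A powr l * mean_on I ?W)" by linarith
    then have "len I' * mean_on I' ?W \<le> len I' * ((D / 2) powr l * (A powr l * mean_on I ?W))"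
      using len' by (intro mult_left_mono) auto
    moreover have eqs: "integral_on I' ?W = len I' * mean_on I' ?W"
        "integral_on I ?W = len I' / 2 * mean_on I ?W"
      using len len' by (simp_all add: integral_on_eq_mean_on)
    ultimately show ?thesis unfolding eqs by (simp add: mult_ac)
  qed
  then show ?thesis unfolding dyadic_doubling_def by blast
qed

text \<open>The hypothesis says \<open>m \<le> C w\<close>, so the lower bound \<open>c (w / m)\<^sup>l\<close> is at least \<open>c / C\<^sup>l\<close>, and \<open>c\<close>
  dominates the mean.\<close>

lemma lambda_op_A_1_cond:
  assumes l: "0 \<le> l" "l \<le> 1" and A: "A_1_cond J w"
  shows "A_1_cond J (lambda_op J w l)"
proof -
  obtain C where C: "\<And>I. I \<in> dyadic J \<Longrightarrow> AE x in lebesgue. x \<in> pts I \<longrightarrow> mean_on I w \<le> C * w x"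
    using A by (auto simp: A_1_cond_def)
  have "AE x in lebesgue. x \<in> pts I \<longrightarrow>
      mean_on I (lambda_op J w l) \<le> C powr l * lambda_op J w l x" if I: "I \<in> dyadic J" for I
  proof -
    obtain m c where node: "node l m I c" using dyadic_is_node[OF I] by blast
    have c: "0 < c" and m: "0 < mean_on I w" using node_pos[OF node l] mean_w_pos[OF I] .
    have c_ge: "mean_on I (lambda_op J w l) \<le> c" by (rule lambda_op_mean_le_on_node[OF node l])
    show ?thesis
      using lambda_op_ge_on_node[OF node l] C[OF I]
    proof eventually_elim
      case (elim x)
      show ?case
      proof
        assume "x \<in> pts I"
        then have w: "0 < w x" and ge: "c * (w x / mean_on I w) powr l \<le> lambda_op J w l x"
          and Cw: "mean_on I w \<le> C * w x"
          using elim by auto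
        have "0 < C" using m w Cw by (smt (verit) mult_nonpos_nonneg)
        have "1 \<le> C * (w x / mean_on I w)" using Cw m by (simp add: field_simps)
        then have "1 \<le> (C * (w x / mean_on I w)) powr l" using l by (simp add: ge_one_powr_ge_zero)
        also have "\<dots> = C powr l * (w x / mean_on I w) powr l"
          by (rule powr_mult)
        finally have "c * 1 \<le> c * (C powr l * (w x / mean_on I w) powr l)"
          using c by (intro mult_left_mono) auto
        also have "\<dots> = C powr l * (c * (w x / mean_on I w) powr l)" by simp
        also have "\<dots> \<le> C powr l * lambda_op J w l x"
          using ge by (intro mult_left_mono) auto
        finally show "mean_on I (lambda_op J w l) \<le> C powr l * lambda_op J w l x"
          using c_ge by linarith
      qed
    qed
  qed
  then show ?thesis unfolding A_1_cond_def by blast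
qed

text \<open>The negative power reverses the pointwise lower bound, and \<open>(w / m)\<^sup>l\<^sup>q\<close> is the \<open>l\<close>-th power of
  \<open>(w / m)\<^sup>q\<close>. A second use of Bernoulli's inequality makes the bound linear in \<open>w\<^sup>q\<close>, so that its
  mean is controlled by the condition on \<open>w\<close>.\<close>

lemma lambda_op_A_p_cond:
  assumes l: "0 \<le> l" "l \<le> 1" and p: "1 < p" and A: "A_p_cond p J w"
  shows "A_p_cond p J (lambda_op J w l)"
proof -
  let ?W = "lambda_op J w l"
  define q where "q = - 1 / (p - 1)"
  have q: "q < 0" "q * (p - 1) = - 1" using p by (simp_all add: q_def)
  obtain C where C: "\<And>I. I \<in> dyadic J \<Longrightarrow> integrable_on_ivl (\<lambda>x. w x powr q) I \<and>
      mean_on I w * mean_on I (\<lambda>x. w x powr q) powr (p - 1) \<le> C"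
    using A by (auto simp: A_p_cond_def q_def)
  define K where "K = 1 - l + l * C powr (- q)"
  have "integrable_on_ivl (\<lambda>x. ?W x powr q) I \<and>
      mean_on I ?W * mean_on I (\<lambda>x. ?W x powr q) powr (p - 1) \<le> K powr (p - 1)"
    if I: "I \<in> dyadic J" for I
  proof -
    let ?m = "mean_on I w" and ?V = "mean_on I (\<lambda>x. w x powr q)"
    obtain n c where node: "node l n I c" using dyadic_is_node[OF I] by blast
    have len: "0 < len I" and c: "0 < c" and m: "0 < ?m"
      using dyadic_len_pos[OF len_J I] node_pos[OF node l] mean_w_pos[OF I] .
    have int: "integrable_on_ivl (\<lambda>x. w x powr q) I" using C[OF I] by simp
    have "AE x in lebesgue. x \<in> pts I \<longrightarrow> 0 < w x powr q"
      using lambda_op_ge_on_node[OF node l] by eventually_elim auto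
    with int have V: "0 < ?V" by (intro mean_on_pos[OF len]) (simp add: is_weight_def)
    have W: "is_weight I ?W"
      using lambda_op_is_weight[OF l] dyadic_subset[OF len_J I] by (rule is_weight_subset)
    define \<alpha> \<beta> where "\<alpha> = c powr q * (1 - l)" and "\<beta> = c powr q * l / ?m powr q"
    have ae: "AE x in lebesgue. x \<in> pts I \<longrightarrow> ?W x powr q \<le> \<alpha> + \<beta> * w x powr q"
      using lambda_op_ge_on_node[OF node l]
    proof eventually_elim
      case (elim x)
      show ?case
      proof
        assume "x \<in> pts I"
        then have w: "0 < w x" and ge: "c * (w x / ?m) powr l \<le> ?W x" using elim by auto
        have "?W x powr q \<le> (c * (w x / ?m) powr l) powr q"
          using ge q c w m by (intro powr_mono2') auto
        also have "\<dots> = c powr q * (w x powr q / ?m powr q) powr l"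
          using c w m by (simp add: powr_mult powr_powr powr_divide mult.commute)
        also have "\<dots> \<le> c powr q * (1 - l + l * (w x powr q / ?m powr q))"
          using w m l by (intro mult_left_mono powr_le_affine) auto
        also have "\<dots> = \<alpha> + \<beta> * w x powr q"
          by (simp add: \<alpha>_def \<beta>_def algebra_simps)
        finally show "?W x powr q \<le> \<alpha> + \<beta> * w x powr q" .
      qed
    qed
    have int_W: "integrable_on_ivl (\<lambda>x. ?W x powr q) I"
    proof (rule integrable_on_ivl_bound)
      show "integrable_on_ivl (\<lambda>x. \<alpha> + \<beta> * w x powr q) I" by (rule integrable_on_ivl_affine[OF int])
      show "(\<lambda>x. indicator (pts I) x *\<^sub>R ?W x powr q) \<in> borel_measurable lebesgue" by measurable
      show "AE x in lebesgue. x \<in> pts I \<longrightarrow> \<bar>?W x powr q\<bar> \<le> \<alpha> + \<beta> * w x powr q"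
        using ae by simp
    qed
    have V_le: "?V \<le> C powr (- q) * ?m powr q"
    proof -
      have "?V = (?V powr (p - 1)) powr (- q)"
        using V q by (simp add: powr_powr mult.commute)
      also have "\<dots> \<le> (C / ?m) powr (- q)"
        using C[OF I] m q by (intro powr_mono2) (auto simp: field_simps)
      also have "\<dots> = C powr (- q) * ?m powr q"
      proof -
        have "0 < ?m * ?V powr (p - 1)" using m V by simp
        with C[OF I] have "0 < C" by linarith
        with m show ?thesis by (simp add: powr_divide powr_minus field_simps)
      qed
      finally show ?thesis .
    qed
    have "mean_on I (\<lambda>x. ?W x powr q) \<le> \<alpha> + \<beta> * ?V"
      by (rule mean_on_le_affine[OF len int_W int ae])
    also have "\<dots> \<le> \<alpha> + \<beta> * (C powr (- q) * ?m powr q)"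
      using V_le c m l by (intro add_left_mono mult_left_mono) (auto simp: \<beta>_def)
    also have "\<dots> = c powr q * K"
      using m by (simp add: \<alpha>_def \<beta>_def K_def algebra_simps)
    finally have mean: "mean_on I (\<lambda>x. ?W x powr q) \<le> c powr q * K" .
    have "AE x in lebesgue. x \<in> pts I \<longrightarrow> 0 < ?W x powr q"
      using W unfolding is_weight_def by (auto elim: eventually_mono)
    with int_W have "0 < mean_on I (\<lambda>x. ?W x powr q)"
      by (intro mean_on_pos[OF len]) (simp add: is_weight_def)
    moreover have K: "0 \<le> K" using l by (simp add: K_def)
    ultimately have "mean_on I (\<lambda>x. ?W x powr q) powr (p - 1) \<le> (c powr q * K) powr (p - 1)"
      using mean p by (intro powr_mono2) auto
    also have "\<dots> = K powr (p - 1) / c"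
      using c K q by (simp add: powr_mult powr_powr powr_neg_one divide_inverse mult.commute)
    finally have "mean_on I ?W * mean_on I (\<lambda>x. ?W x powr q) powr (p - 1) \<le> c * (K powr (p - 1) / c)"
      using lambda_op_mean_le_on_node(2)[OF node l] c by (intro mult_mono) auto
    with int_W c show ?thesis by simp
  qed
  then show ?thesis unfolding A_p_cond_def q_def by blast
qed

end

section \<open>The inclusion in the limiting class\<close>

text \<open>The condition bounds \<open>ln w\<close> below by \<open>ln (m / C)\<close>, where \<open>m\<close> is the mean of \<open>w\<close>. The constant is
  replaced by \<open>max C 1\<close> to have it positive.\<close>

lemma A_1_imp_A_infty:
  assumes len_J: "0 < len J" and w: "is_weight J w" and A: "A_1_cond J w"
  shows "A_infty_cond J w"
proof -
  obtain C where C: "\<And>I. I \<in> dyadic J \<Longrightarrow> AE x in lebesgue. x \<in> pts I \<longrightarrow> mean_on I w \<le> C * w x"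
    using A by (auto simp: A_1_cond_def)
  have "integrable_on_ivl (\<lambda>x. ln (w x)) I \<and> mean_on I w \<le> max C 1 * exp (mean_on I (\<lambda>x. ln (w x)))"
    if I: "I \<in> dyadic J" for I
  proof -
    let ?m = "mean_on I w" and ?C = "max C 1"
    have len: "0 < len I" using dyadic_len_pos[OF len_J I] .
    have wI: "is_weight I w" using w dyadic_subset[OF len_J I] by (rule is_weight_subset)
    then have int: "integrable_on_ivl w I" and pos: "AE x in lebesgue. x \<in> pts I \<longrightarrow> 0 < w x"
      by (auto simp: is_weight_def)
    have m: "0 < ?m" by (rule mean_on_pos[OF len wI])
    have ge: "AE x in lebesgue. x \<in> pts I \<longrightarrow> 0 < w x \<and> ln (?m / ?C) \<le> ln (w x)"
      using pos C[OF I]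
    proof eventually_elim
      case (elim x)
      show ?case
      proof
        assume "x \<in> pts I"
        then have w: "0 < w x" "?m \<le> C * w x" using elim by auto
        have "C * w x \<le> ?C * w x" using w by (intro mult_right_mono) auto
        with w have "?m \<le> ?C * w x" by linarith
        then have "?m / ?C \<le> w x" by (subst pos_divide_le_eq) (auto simp: mult.commute)
        with m w show "0 < w x \<and> ln (?m / ?C) \<le> ln (w x)" by simp
      qed
    qed
    have ln_int: "integrable_on_ivl (\<lambda>x. ln (w x)) I"
    proof (rule integrable_on_ivl_bound)
      show "integrable_on_ivl (\<lambda>x. \<bar>ln (?m / ?C)\<bar> + 1 * w x) I"
        by (rule integrable_on_ivl_affine[OF int])
      show "(\<lambda>x. indicator (pts I) x *\<^sub>R ln (w x)) \<in> borel_measurable lebesgue"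
        by (rule integrable_on_ivl_measurable_ln[OF int])
      show "AE x in lebesgue. x \<in> pts I \<longrightarrow> \<bar>ln (w x)\<bar> \<le> \<bar>ln (?m / ?C)\<bar> + 1 * w x"
        using ge
      proof eventually_elim
        case (elim x)
        then show ?case using ln_less_self[of "w x"] by (smt (verit) mult_1)
      qed
    qed
    have "ln (?m / ?C) + 0 * mean_on I w \<le> mean_on I (\<lambda>x. ln (w x))"
      using ge by (intro mean_on_ge_affine[OF len ln_int int]) (auto elim: eventually_mono)
    then have "exp (ln (?m / ?C)) \<le> exp (mean_on I (\<lambda>x. ln (w x)))" by simp
    then have "?m / ?C \<le> exp (mean_on I (\<lambda>x. ln (w x)))" using m by simp
    then show ?thesis using ln_int by (simp add: field_simps)
  qed
  then show ?thesis unfolding A_infty_cond_def by blast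
qed

text \<open>With \<open>q = - 1 / (p - 1)\<close> and \<open>V\<close> the mean of \<open>w\<^sup>q\<close>, Jensen's inequality for \<open>ln (w\<^sup>q) = q ln w\<close> bounds
  the mean of \<open>ln w\<close> from below by \<open>- (p - 1) ln V\<close>. The hypothesis bounds the mean of \<open>w\<close> by
  \<open>C V\<^sup>-\<^sup>(\<^sup>p\<^sup>-\<^sup>1\<^sup>)\<close>, the exponential of that lower bound times \<open>C\<close>.\<close>

lemma A_p_imp_A_infty:
  assumes len_J: "0 < len J" and w: "is_weight J w" and p: "1 < p" and A: "A_p_cond p J w"
  shows "A_infty_cond J w"
proof -
  define q where "q = - 1 / (p - 1)"
  have q: "q < 0" "q * (p - 1) = - 1" using p by (simp_all add: q_def)
  obtain C where C: "\<And>I. I \<in> dyadic J \<Longrightarrow> integrable_on_ivl (\<lambda>x. w x powr q) I \<and>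
      mean_on I w * mean_on I (\<lambda>x. w x powr q) powr (p - 1) \<le> C"
    using A by (auto simp: A_p_cond_def q_def)
  have "integrable_on_ivl (\<lambda>x. ln (w x)) I \<and> mean_on I w \<le> C * exp (mean_on I (\<lambda>x. ln (w x)))"
    if I: "I \<in> dyadic J" for I
  proof -
    let ?v = "\<lambda>x. w x powr q" and ?m = "mean_on I w"
    let ?V = "mean_on I ?v" and ?L = "mean_on I (\<lambda>x. ln (w x))"
    have len: "0 < len I" using dyadic_len_pos[OF len_J I] .
    have wI: "is_weight I w" using w dyadic_subset[OF len_J I] by (rule is_weight_subset)
    then have int: "integrable_on_ivl w I" and pos: "AE x in lebesgue. x \<in> pts I \<longrightarrow> 0 < w x"
      by (auto simp: is_weight_def)
    have "AE x in lebesgue. x \<in> pts I \<longrightarrow> 0 < ?v x"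
      using pos by eventually_elim auto
    then have v: "is_weight I ?v" using C[OF I] by (simp add: is_weight_def)
    have V: "0 < ?V" by (rule mean_on_pos[OF len v])
    have int_v: "integrable_on_ivl ?v I" using C[OF I] by simp
    have ln_int: "integrable_on_ivl (\<lambda>x. ln (w x)) I"
    proof (rule integrable_on_ivl_bound)
      show "integrable_on_ivl (\<lambda>x. (0 + (- 1 / q) * ?v x) + w x) I"
        using int integrable_on_ivl_affine[OF int_v, of 0 "- 1 / q"]
        unfolding integrable_on_ivl_def by (intro set_integral_add) auto
      show "(\<lambda>x. indicator (pts I) x *\<^sub>R ln (w x)) \<in> borel_measurable lebesgue"
        by (rule integrable_on_ivl_measurable_ln[OF int])
      show "AE x in lebesgue. x \<in> pts I \<longrightarrow> \<bar>ln (w x)\<bar> \<le> (0 + (- 1 / q) * ?v x) + w x"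
        using pos
      proof eventually_elim
        case (elim x)
        show ?case
        proof
          assume "x \<in> pts I"
          then have w: "0 < w x" using elim by simp
          have "q * ln (w x) < ?v x" using ln_less_self[of "?v x"] w by (simp add: ln_powr)
          then have "- ln (w x) < (- 1 / q) * ?v x" using q(1) by (simp add: field_simps)
          moreover have "0 < (- 1 / q) * ?v x"
            using q(1) w by (intro mult_pos_pos) (auto simp: field_simps)
          ultimately show "\<bar>ln (w x)\<bar> \<le> (0 + (- 1 / q) * ?v x) + w x"
            using ln_less_self[OF w] w by linarith
        qed
      qed
    qed
    have ln_v: "(\<lambda>x. ln (?v x)) = (\<lambda>x. 0 + q * ln (w x))"
      by (simp add: ln_powr)
    have "mean_on I (\<lambda>x. ln (?v x)) \<le> ln ?V"
      using v integrable_on_ivl_affine[OF ln_int, of 0 q] unfolding ln_v[symmetric]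
      by (intro mean_on_ln_le[OF len]) auto
    then have "q * ?L \<le> ln ?V"
      unfolding ln_v mean_on_affine[OF len ln_int] by simp
    then have "(p - 1) * (q * ?L) \<le> (p - 1) * ln ?V"
      using p by (intro mult_left_mono) auto
    moreover have "(p - 1) * (q * ?L) = (q * (p - 1)) * ?L" by simp
    ultimately have "- ?L \<le> (p - 1) * ln ?V" using q by simp
    then have "exp (- ?L) \<le> ?V powr (p - 1)" using V by (simp add: powr_def)
    then have "?m * exp (- ?L) \<le> ?m * ?V powr (p - 1)"
      using mean_on_pos[OF len wI] by (intro mult_left_mono) auto
    also have "\<dots> \<le> C" using C[OF I] by simp
    finally have "?m \<le> C * exp ?L" by (simp add: exp_minus field_simps)
    with ln_int show ?thesis by simp
  qed
  then show ?thesis unfolding A_infty_cond_def by blast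
qed

section \<open>Stability of the classes\<close>

theorem theorem1p2:
  fixes a b :: real and p :: ereal and \<omega> :: "real \<Rightarrow> real"
  assumes "a < b"
    and "1 \<le> p"
    and "is_weight (a, b) \<omega>"
    and "mean_on (a, b) \<omega> = 1"
    and "\<omega> \<in> A_dyadic p (a, b)"
  shows "\<forall>l. 0 \<le> l \<and> l \<le> 1 \<longrightarrow>
    (AE x in lebesgue. x \<in> pts (a, b) \<longrightarrow> convergent (\<lambda>n. lambda_partial (a, b) \<omega> l n x)) \<and>
    lambda_op (a, b) \<omega> l \<in> A_dyadic p (a, b)"
proof (intro allI impI conjI)
  fix l :: real assume "0 \<le> l \<and> l \<le> 1"
  then have l: "0 \<le> l" "l \<le> 1" by auto
  have len: "0 < len (a, b)" using assms(1) by (simp add: len_def)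
  interpret weight_on_interval "(a, b)" \<omega>
    using len assms(3) by unfold_locales
  show "AE x in lebesgue. x \<in> pts (a, b) \<longrightarrow> convergent (\<lambda>n. lambda_partial (a, b) \<omega> l n x)"
    using lambda_partial_tendsto[OF l] by eventually_elim (auto intro: convergentI)
  have doubling: "dyadic_doubling (a, b) \<omega>" using assms(5) by (simp add: A_dyadic_def)
  consider "p = \<infinity>" "A_infty_cond (a, b) \<omega>" | "p = 1" "A_1_cond (a, b) \<omega>"
    | "p \<noteq> \<infinity>" "p \<noteq> 1" "1 < real_of_ereal p" "A_p_cond (real_of_ereal p) (a, b) \<omega>"
  proof -
    have "1 < real_of_ereal p" if "p \<noteq> \<infinity>" "p \<noteq> 1"
      using assms(2) that by (cases p) (auto simp: one_ereal_def)
    then show thesis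
      using assms(5) that by (auto simp: A_dyadic_def split: if_splits)
  qed
  then show "lambda_op (a, b) \<omega> l \<in> A_dyadic p (a, b)"
  proof cases
    case 1
    then show ?thesis
      using l lambda_op_is_weight lambda_op_doubling[OF _ _ _ doubling] lambda_op_A_infty_cond
      by (simp add: A_dyadic_def)
  next
    case 2
    then show ?thesis
      using l lambda_op_is_weight lambda_op_doubling[OF _ _ _ doubling] lambda_op_A_1_cond
        A_1_imp_A_infty[OF len assms(3)]
      by (simp add: A_dyadic_def)
  next
    case 3
    then show ?thesis
      using l lambda_op_is_weight lambda_op_doubling[OF _ _ _ doubling] lambda_op_A_p_cond
        A_p_imp_A_infty[OF len assms(3)]
      by (simp add: A_dyadic_def)
  qed
qed

end
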